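(* Let $d\in\{1,2,3,4\}$. Then for any two experts $q,r$ there is a choice of $\{\beta_m\}_{m=0}^{2^d-1}$ that achieves indifference, i.e. there exist real numbers $\beta_0,\dots,\beta_{2^d-1}$ and $M$ such that $$\sum_{m\text{ on }s}\big[(q(m)-r(m))^2-b_{s,m}\beta_m\big]=|s|\,M\quad\text{for every simple cycle } s.$$ Consequently, for $d\le 4$ the investor's linear program and the market's linear program have the same optimal value.
   Context: The states are $m=(a_1,\dots,a_d)\in\{0,1\}^d$, identified with the integers $0,\dots,2^d-1$ by reading $a_1\cdots a_d$ in binary. For a state $m$ put $m_+=(a_2,\dots,a_d,1)$ and $m_-=(a_2,\dots,a_d,0)$. Two experts are given by functions $q,r:\{0,1\}^d\to\mathbb{R}$ with $|q(m)|<1$ and $|r(m)|<1$ for all $m$, and $q(m)\ne r(m)$ for at least one $m$. Consider the directed graph (the $d$-dimensional de Bruijn graph on 2 symbols) with vertex set $\{0,1\}^d$ and edges from $m$ to $m_+$ and from $m$ to $m_-$ for each $m$. A simple cycle is a closed walk with at least one edge and no repeated vertices apart from the first and last, which are equal (loops count as simple cycles of length one; cycles differing only in the starting vertex are identified). For a simple cycle $s$ let $|s|$ be its number of edges, and for a vertex $m$ on $s$ let $b_{s,m}=+1$ if $s$ leaves $m$ by the edge to $m_+$ and $b_{s,m}=-1$ if it leaves $m$ by the edge to $m_-$. The investor's linear program is: over $(\beta_0,\dots,\beta_{2^d-1},M)\in\mathbb{R}^{2^d+1}$, minimize $M$ subject to $$\sum_{m\text{ on }s}\big[(q(m)-r(m))^2-b_{s,m}\beta_m\big]\le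 |s|\,M\quad\text{for every simple cycle } s.$$ The market's linear program is: maximize $M$ subject to the same constraints with $\le$ replaced by $\ge$. *)

theory Defs
  imports Complex_Main "Graph_Theory.Graph_Theory"
begin

(* A state (a_1,...,a_d) is the list [a_1,...,a_d] with True for 1 and False for 0.  Functions of
   a state, including beta, are indexed by the state itself instead of by the integer with binary
   digits a_1 ... a_d; their values outside "states d" play no role. *)
definition states :: "nat \<Rightarrow> bool list set" where
  "states d = {m. length m = d}"

definition state_plus :: "bool list \<Rightarrow> bool list" where
  "state_plus m = tl m @ [True]"

definition state_minus :: "bool list \<Rightarrow> bool list" where
  "state_minus m = tl m @ [False]"

definition expert :: "nat \<Rightarrow> (bool list \<Rightarrow> real) \<Rightarrow> bool" where
  "expert d q \<longleftrightarrow> (\<forall>m\<in>states d. \<bar>q m\<bar> < 1)"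

(* The arc (m, True) is the edge from m to m_+, the arc (m, False) the edge from m to m_-. *)
definition de_bruijn :: "nat \<Rightarrow> (bool list, bool list \<times> bool) pre_digraph" where
  "de_bruijn d = \<lparr> verts = states d, arcs = states d \<times> UNIV,
     tail = fst, head = (\<lambda>(m, b). if b then state_plus m else state_minus m) \<rparr>"

lemma fin_digraph_de_bruijn:
  assumes "d \<ge> 1"
  shows "fin_digraph (de_bruijn d)"
proof
  have "states d = {m. set m \<subseteq> UNIV \<and> length m = d}"
    by (simp add: states_def)
  then have fin: "finite (states d)"
    using finite_lists_length_eq[of "UNIV :: bool set" d] by simp
  then show "finite (verts (de_bruijn d))" "finite (arcs (de_bruijn d))"
    by (simp_all add: de_bruijn_def)
qed (use assms in \<open>auto simp: de_bruijn_def states_def state_plus_def state_minus_def\<close>)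

(* "pre_digraph.cycle" is a nonempty closed walk, given by its list of arcs, without repeated
   vertices other than its two ends; loops are allowed.  Each choice of the starting vertex gives
   a different list, but everything below depends only on the set of arcs and on the length, so
   quantifying over the lists is the same as quantifying over cycles up to the starting vertex. *)
abbreviation simple_cycle :: "nat \<Rightarrow> (bool list \<times> bool) list \<Rightarrow> bool" where
  "simple_cycle d s \<equiv> pre_digraph.cycle (de_bruijn d) s"

definition cycle_states :: "(bool list \<times> bool) list \<Rightarrow> bool list set" where
  "cycle_states s = fst ` set s"

(* b_{s,m} for a state m on s: a simple cycle leaves each of its states by exactly one arc. *)
definition cycle_sign :: "(bool list \<times> bool) list \<Rightarrow> bool list \<Rightarrow> real" where
  "cycle_sign s m = (if (m, True) \<in> set s then 1 else -1)"

definition cycle_sum ::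
  "(bool list \<Rightarrow> real) \<Rightarrow> (bool list \<Rightarrow> real) \<Rightarrow> (bool list \<Rightarrow> real) \<Rightarrow> (bool list \<times> bool) list \<Rightarrow> real" where
  "cycle_sum q r \<beta> s = (\<Sum>m\<in>cycle_states s. (q m - r m)\<^sup>2 - cycle_sign s m * \<beta> m)"

definition investor_feasible ::
  "nat \<Rightarrow> (bool list \<Rightarrow> real) \<Rightarrow> (bool list \<Rightarrow> real) \<Rightarrow> (bool list \<Rightarrow> real) \<Rightarrow> real \<Rightarrow> bool" where
  "investor_feasible d q r \<beta> M \<longleftrightarrow>
     (\<forall>s. simple_cycle d s \<longrightarrow> cycle_sum q r \<beta> s \<le> real (length s) * M)"

definition market_feasible ::
  "nat \<Rightarrow> (bool list \<Rightarrow> real) \<Rightarrow> (bool list \<Rightarrow> real) \<Rightarrow> (bool list \<Rightarrow> real) \<Rightarrow> real \<Rightarrow> bool" where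
  "market_feasible d q r \<beta> M \<longleftrightarrow>
     (\<forall>s. simple_cycle d s \<longrightarrow> cycle_sum q r \<beta> s \<ge> real (length s) * M)"

(* The optimal value is attained by definition, as for every feasible bounded linear program. *)
definition investor_optimal_value ::
  "nat \<Rightarrow> (bool list \<Rightarrow> real) \<Rightarrow> (bool list \<Rightarrow> real) \<Rightarrow> real \<Rightarrow> bool" where
  "investor_optimal_value d q r V \<longleftrightarrow>
     (\<exists>\<beta>. investor_feasible d q r \<beta> V) \<and> (\<forall>\<beta> M. investor_feasible d q r \<beta> M \<longrightarrow> V \<le> M)"

definition market_optimal_value ::
  "nat \<Rightarrow> (bool list \<Rightarrow> real) \<Rightarrow> (bool list \<Rightarrow> real) \<Rightarrow> real \<Rightarrow> bool" where
  "market_optimal_value d q r V \<longleftrightarrow>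
     (\<exists>\<beta>. market_feasible d q r \<beta> V) \<and> (\<forall>\<beta> M. market_feasible d q r \<beta> M \<longrightarrow> M \<le> V)"

end

theory Submission
  imports Defs
begin

text \<open>
  Write \<open>c m = (q m - r m)\<^sup>2\<close> and give the arc \<open>(m, b)\<close> the weight
  \<open>c m - \<plusminus> \<beta> m - M\<close>.  A cycle constraint of either linear program compares the total weight
  of a cycle with 0, so indifference asks for \<open>\<beta>\<close> and \<open>M\<close> that make every cycle have total
  weight 0.  This is achieved as soon as the weight of each arc is the increment
  \<open>\<phi> (head) - \<phi> (tail)\<close> of a potential \<open>\<phi>\<close>.  The two arcs leaving \<open>m\<close> give two equations:
  their difference can be solved for \<open>\<beta> m\<close>, and their mean is the Poisson equation
  \<open>P \<phi> - \<phi> = c - M\<close> for the operator \<open>P\<close> that averages over the two successors of a state.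
  After \<open>d\<close> steps all digits of the state have been replaced by fresh ones, so \<open>P\<^sup>d c\<close> is
  constant on the states; taking \<open>M\<close> to be this constant, \<open>\<phi> = - (\<Sum>k<d. P\<^sup>k c)\<close> solves the
  Poisson equation (\<open>indifference_exists\<close>).

  For the optimal value, the signs \<open>\<plusminus> \<beta> m\<close> cancel in the sum of the weights over all arcs, which is
  \<open>2 * (\<Sum>m. c m - M)\<close>.  If every cycle has nonpositive weight, then so does every closed walk, and
  hence also this sum, because the arcs can be covered uniformly by closed walks: an arc
  is a word of \<open>d + 1\<close> digits, and reading such a word circularly gives a closed walk
  through its \<open>d + 1\<close> rotations (\<open>sum_arcs_nonpos_if_cycles_nonpos\<close>).  So an investor-feasible
  \<open>M\<close> is at least the mean of \<open>c\<close>, a market-feasible one at most this mean, and an indifferent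
  \<open>M\<close>, being feasible for both, is the optimum of both.
\<close>

section \<open>Arc weights along closed walks\<close>

lemma (in wf_digraph) sum_list_awalk_potential:
  fixes \<phi> :: "'a \<Rightarrow> real"
  assumes "awalk u p v" and "\<And>e. e \<in> arcs G \<Longrightarrow> f e = \<phi> (head G e) - \<phi> (tail G e)"
  shows "sum_list (map f p) = \<phi> v - \<phi> u"
  using assms(1)
proof (induction p arbitrary: u)
  case Nil
  then show ?case by (simp add: awalk_Nil_iff)
next
  case (Cons e p)
  then show ?case using assms(2)[of e] by (auto simp: awalk_Cons_iff)
qed

text \<open>A closed walk that repeats an inner vertex splits there into two shorter closed walks.\<close>
lemma (in wf_digraph) closed_walk_nonpos_if_cycles_nonpos:
  fixes f :: "'b \<Rightarrow> real"
  assumes cyc: "\<And>s. cycle s \<Longrightarrow> sum_list (map f s) \<le> 0" and "awalk u p u"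
  shows "sum_list (map f p) \<le> 0"
  using assms(2)
proof (induction "length p" arbitrary: u p rule: less_induct)
  case less
  show ?case
  proof (cases p)
    case Nil
    then show ?thesis by simp
  next
    case (Cons e es)
    show ?thesis
    proof (cases "distinct (awalk_verts (head G e) es)")
      case True
      then have "cycle p" using less.prems Cons unfolding cycle_def by auto
      then show ?thesis by (rule cyc)
    next
      case False
      have es: "awalk (head G e) es u" and e: "e \<in> arcs G" "tail G e = u"
        using less.prems Cons by (auto simp: awalk_Cons_iff)
      obtain x y z w where split: "es = x @ y @ z" "0 < length y"
        and w: "awalk (head G e) x w" "awalk w y w" "awalk w z u"
        using awalk_not_distinct_decomp[OF es False] by blast
      have "awalk u (e # x @ z) u"
        using w e by (auto simp: awalk_Cons_iff)
      then have "sum_list (map f (e # x @ z)) \<le> 0"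
        using less.hyps[of "e # x @ z"] Cons split by simp
      moreover have "sum_list (map f y) \<le> 0"
        using less.hyps[of y] w(2) Cons split by simp
      ultimately show ?thesis using Cons split by simp
    qed
  qed
qed

text \<open>The tails around a cycle are a rotation of the heads, which are distinct by definition.\<close>
lemma (in wf_digraph) distinct_tails_cycle:
  assumes "cycle s"
  shows "distinct (map (tail G) s)"
proof -
  obtain u where u: "awalk u s u" "distinct (tl (awalk_verts u s))" "s \<noteq> []"
    using assms unfolding cycle_def by auto
  have heads: "awalk_verts u s = tail G (hd s) # map (head G) s"
    using u by (auto simp: awalk_verts_conv' awalk_def)
  have tails: "awalk_verts u s = map (tail G) s @ [head G (last s)]"
    using u(3) by (simp add: awalk_verts_conv)
  have "tail G (hd s) = u" "head G (last s) = u"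
    using u(1,3) heads tails
    by (metis awhd_if_cas awlast_if_cas awalk_def last_snoc list.sel(1))+
  then have "mset (map (head G) s) = mset (map (tail G) s)"
    using arg_cong[OF trans[OF heads[symmetric] tails], of mset] by simp
  moreover have "distinct (map (head G) s)" using u(2) heads by simp
  ultimately show ?thesis by (metis mset_eq_imp_distinct_iff)
qed

section \<open>Uniform covering of the arcs by closed walks\<close>

lemma finite_states: "finite (states d)"
proof -
  have "states d = {m. set m \<subseteq> UNIV \<and> length m = d}"
    by (simp add: states_def)
  then show ?thesis
    using finite_lists_length_eq[of "UNIV :: bool set" d] by simp
qed

lemma wf_digraph_de_bruijn: "d \<ge> 1 \<Longrightarrow> wf_digraph (de_bruijn d)"
  by (rule fin_digraph.axioms(1)[OF fin_digraph_de_bruijn])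

definition arc_of_word :: "bool list \<Rightarrow> bool list \<times> bool" where
  "arc_of_word w = (butlast w, last w)"

lemma bij_betw_arc_of_word: "bij_betw arc_of_word (states (Suc d)) (states d \<times> UNIV)"
proof (rule bij_betw_byWitness[where f' = "\<lambda>(m, b). m @ [b]"])
  show "\<forall>w\<in>states (Suc d). (case arc_of_word w of (m, b) \<Rightarrow> m @ [b]) = w"
    by (auto simp: arc_of_word_def states_def intro!: append_butlast_last_id)
qed (auto simp: arc_of_word_def states_def)

lemma bij_betw_rotate: "bij_betw (rotate k) (states n) (states n)"
proof (rule bij_betw_imageI)
  show inj: "inj_on (rotate k) (states n)"
    unfolding rotate_def by (rule inj_on_subset[OF inj_fn[OF inj_rotate1] subset_UNIV])
  have "rotate k ` states n \<subseteq> states n" by (auto simp: states_def)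
  then show "rotate k ` states n = states n"
    by (rule endo_inj_surj[OF finite_states _ inj])
qed

text \<open>The window of a rotated word moves on by one digit, which is a step of the graph.\<close>
lemma awalk_rotations:
  assumes "d \<ge> 1" and "w \<in> states (Suc d)"
  shows "pre_digraph.awalk (de_bruijn d) (butlast w)
           (map (\<lambda>k. arc_of_word (rotate k w)) [0..<n]) (butlast (rotate n w))"
proof -
  interpret wf_digraph "de_bruijn d" by (rule wf_digraph_de_bruijn[OF assms(1)])
  show ?thesis
  proof (induction n)
    case 0
    then show ?case using assms by (simp add: awalk_Nil_iff) (simp add: de_bruijn_def states_def)
  next
    case (Suc n)
    have len: "length (rotate n w) = Suc d" using assms(2) by (simp add: states_def)
    have arc: "arc_of_word v \<in> arcs (de_bruijn d)" "tail (de_bruijn d) (arc_of_word v) = butlast v"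
      "head (de_bruijn d) (arc_of_word v) = butlast (rotate1 v)"
      "butlast (rotate1 v) \<in> verts (de_bruijn d)"
      if "length v = Suc d" for v
    proof -
      obtain a v' where v': "v = a # v'" "length v' = d"
        using \<open>length v = Suc d\<close> by (auto simp: length_Suc_conv)
      moreover obtain m b where "v' = m @ [b]"
        using v'(2) assms(1) by (cases v' rule: rev_cases) auto
      ultimately have v: "v = a # m @ [b]" "length m = d - 1" by auto
      show "arc_of_word v \<in> arcs (de_bruijn d)" "tail (de_bruijn d) (arc_of_word v) = butlast v"
        "head (de_bruijn d) (arc_of_word v) = butlast (rotate1 v)"
        "butlast (rotate1 v) \<in> verts (de_bruijn d)"
        using v assms(1) by (auto simp: arc_of_word_def de_bruijn_def states_def state_plus_def
            state_minus_def butlast_append)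
    qed
    have "awalk (butlast (rotate n w)) [arc_of_word (rotate n w)] (butlast (rotate (Suc n) w))"
      using arc[OF len] by (simp add: awalk_Cons_iff awalk_Nil_iff)
    with Suc show ?case by auto
  qed
qed

text \<open>The closed walks of all words of \<open>d + 1\<close> digits together run \<open>d + 1\<close> times through each
  arc, because each rotation permutes the words.\<close>
lemma sum_arcs_nonpos_if_cycles_nonpos:
  fixes f :: "bool list \<times> bool \<Rightarrow> real"
  assumes "d \<ge> 1" and "\<And>s. simple_cycle d s \<Longrightarrow> sum_list (map f s) \<le> 0"
  shows "(\<Sum>m\<in>states d. f (m, True) + f (m, False)) \<le> 0"
proof -
  interpret wf_digraph "de_bruijn d" by (rule wf_digraph_de_bruijn[OF assms(1)])
  have walk: "(\<Sum>k<Suc d. f (arc_of_word (rotate k w))) \<le> 0" if "w \<in> states (Suc d)" for w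
  proof -
    have "rotate (Suc d) w = w" using that by (simp add: states_def del: rotate_Suc)
    then have "awalk (butlast w) (map (\<lambda>k. arc_of_word (rotate k w)) [0..<Suc d]) (butlast w)"
      using awalk_rotations[OF assms(1) that, of "Suc d"] by simp
    from closed_walk_nonpos_if_cycles_nonpos[OF assms(2) this]
    show ?thesis by (simp add: comp_def interv_sum_list_conv_sum_set_nat atLeast0LessThan del: upt_Suc)
  qed
  have "real (Suc d) * (\<Sum>w\<in>states (Suc d). f (arc_of_word w))
      = (\<Sum>k<Suc d. \<Sum>w\<in>states (Suc d). f (arc_of_word (rotate k w)))"
    by (simp add: sum.reindex_bij_betw[OF bij_betw_rotate, of "\<lambda>w. f (arc_of_word w)"]
        del: sum.lessThan_Suc)
  also have "\<dots> = (\<Sum>w\<in>states (Suc d). \<Sum>k<Suc d. f (arc_of_word (rotate k w)))"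
    by (rule sum.swap)
  also have "\<dots> \<le> 0" by (intro sum_nonpos walk)
  finally have "(\<Sum>w\<in>states (Suc d). f (arc_of_word w)) \<le> 0"
    by (simp add: mult_le_0_iff)
  also have "(\<Sum>w\<in>states (Suc d). f (arc_of_word w)) = (\<Sum>e\<in>states d \<times> UNIV. f e)"
    by (rule sum.reindex_bij_betw[OF bij_betw_arc_of_word])
  also have "\<dots> = (\<Sum>m\<in>states d. \<Sum>b\<in>UNIV. f (m, b))"
    by (simp add: sum.cartesian_product finite_states)
  finally show ?thesis by (simp add: UNIV_bool add.commute)
qed

section \<open>Cycle constraints as weights\<close>

definition arc_weight ::
  "(bool list \<Rightarrow> real) \<Rightarrow> (bool list \<Rightarrow> real) \<Rightarrow> (bool list \<Rightarrow> real) \<Rightarrow> real \<Rightarrow> bool list \<times> bool \<Rightarrow> real"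
  where "arc_weight q r \<beta> M = (\<lambda>(m, b). (q m - r m)\<^sup>2 - (if b then \<beta> m else - \<beta> m) - M)"

text \<open>A cycle leaves each of its states by one arc only, so the sum over its states in the linear
  programs is a sum over its arcs.\<close>
lemma sum_list_arc_weight_cycle:
  assumes "d \<ge> 1" and "simple_cycle d s"
  shows "sum_list (map (arc_weight q r \<beta> M) s) = cycle_sum q r \<beta> s - real (length s) * M"
proof -
  interpret wf_digraph "de_bruijn d" by (rule wf_digraph_de_bruijn[OF assms(1)])
  have dist: "distinct (map fst s)"
    using distinct_tails_cycle[OF assms(2)] by (simp add: de_bruijn_def)
  then have inj: "inj_on fst (set s)" and ds: "distinct s"
    by (simp_all add: distinct_map)
  have sign: "arc_weight q r \<beta> M e = ((q (fst e) - r (fst e))\<^sup>2 - cycle_sign s (fst e) * \<beta> (fst e)) - M"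
    if "e \<in> set s" for e
  proof (cases e)
    case (Pair m b)
    have "(m, True) \<in> set s \<longleftrightarrow> b"
      using that Pair inj_onD[OF inj, of "(m, True)" "(m, False)"] by (cases b) auto
    then show ?thesis by (simp add: Pair arc_weight_def cycle_sign_def)
  qed
  have "sum_list (map (arc_weight q r \<beta> M) s) = (\<Sum>e\<in>set s. arc_weight q r \<beta> M e)"
    using ds by (rule sum_list_distinct_conv_sum_set)
  also have "\<dots> = cycle_sum q r \<beta> s - real (card (set s)) * M"
    by (simp add: sign cycle_sum_def cycle_states_def sum.reindex[OF inj] sum_subtractf)
  finally show ?thesis using ds by (simp add: distinct_card)
qed

lemma sum_states_arc_weight:
  "(\<Sum>m\<in>states d. arc_weight q r \<beta> M (m, True) + arc_weight q r \<beta> M (m, False))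
    = 2 * ((\<Sum>m\<in>states d. (q m - r m)\<^sup>2) - real (card (states d)) * M)"
  by (simp add: arc_weight_def sum_subtractf sum.distrib algebra_simps sum_distrib_left)

lemma investor_feasible_ge_mean:
  assumes "d \<ge> 1" and "investor_feasible d q r \<beta> M"
  shows "(\<Sum>m\<in>states d. (q m - r m)\<^sup>2) \<le> real (card (states d)) * M"
  using sum_arcs_nonpos_if_cycles_nonpos[OF assms(1), of "arc_weight q r \<beta> M"] assms
  by (simp add: sum_states_arc_weight sum_list_arc_weight_cycle investor_feasible_def)

lemma market_feasible_le_mean:
  assumes "d \<ge> 1" and "market_feasible d q r \<beta> M"
  shows "real (card (states d)) * M \<le> (\<Sum>m\<in>states d. (q m - r m)\<^sup>2)"
proof -
  have "sum_list (map (\<lambda>e. - arc_weight q r \<beta> M e) s) \<le> 0" if "simple_cycle d s" for s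
    using that assms sum_list_arc_weight_cycle[OF assms(1) that, of q r \<beta> M]
    by (simp add: market_feasible_def uminus_sum_list_map[symmetric, unfolded comp_def])
  from sum_arcs_nonpos_if_cycles_nonpos[OF assms(1) this]
  have "0 \<le> (\<Sum>m\<in>states d. arc_weight q r \<beta> M (m, True) + arc_weight q r \<beta> M (m, False))"
    by (simp add: sum_subtractf sum.distrib sum_negf)
  then show ?thesis by (simp add: sum_states_arc_weight)
qed

section \<open>Indifference\<close>

definition successor_mean :: "(bool list \<Rightarrow> real) \<Rightarrow> bool list \<Rightarrow> real" where
  "successor_mean g m = (g (state_plus m) + g (state_minus m)) / 2"

text \<open>After \<open>k\<close> steps the first \<open>k\<close> digits are forgotten.\<close>
lemma funpow_successor_mean_cong:
  assumes "length m = length n" and "drop k m = drop k n"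
  shows "(successor_mean ^^ k) c m = (successor_mean ^^ k) c n"
  using assms
proof (induction k arbitrary: m n)
  case 0
  then show ?case by simp
next
  case (Suc k)
  have "(successor_mean ^^ k) c (tl m @ [b]) = (successor_mean ^^ k) c (tl n @ [b])" for b
    using Suc.prems by (intro Suc.IH) (simp_all add: drop_Suc)
  then show ?case
    by (simp add: successor_mean_def[of "(successor_mean ^^ k) c"] state_plus_def state_minus_def)
qed

lemma indifference_exists:
  assumes "d \<ge> 1"
  shows "\<exists>\<beta> M. \<forall>s. simple_cycle d s \<longrightarrow> cycle_sum q r \<beta> s = real (length s) * M"
proof -
  interpret wf_digraph "de_bruijn d" by (rule wf_digraph_de_bruijn[OF assms])
  define c where "c m = (q m - r m)\<^sup>2" for m
  define \<phi> where "\<phi> m = - (\<Sum>k<d. (successor_mean ^^ k) c m)" for m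
  \<comment> \<open>The value of \<open>P\<^sup>d c\<close> on all states, by \<open>funpow_successor_mean_cong\<close>.\<close>
  define M where "M = (successor_mean ^^ d) c (replicate d True)"
  define \<beta> where "\<beta> m = (\<phi> (state_minus m) - \<phi> (state_plus m)) / 2" for m
  have poisson: "successor_mean \<phi> m - \<phi> m = c m - M" if "m \<in> states d" for m
  proof -
    have "successor_mean \<phi> m = - (\<Sum>k<d. (successor_mean ^^ Suc k) c m)"
      by (simp add: successor_mean_def[of "(successor_mean ^^ _) c"] successor_mean_def[of \<phi>] \<phi>_def
          sum.distrib sum_divide_distrib[symmetric] field_simps)
    then have "successor_mean \<phi> m - \<phi> m
        = - (\<Sum>k<d. (successor_mean ^^ Suc k) c m - (successor_mean ^^ k) c m)"
      by (simp add: \<phi>_def sum_subtractf)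
    also have "\<dots> = c m - (successor_mean ^^ d) c m"
      by (subst sum_lessThan_telescope[of "\<lambda>k. (successor_mean ^^ k) c m"]) simp
    also have "(successor_mean ^^ d) c m = M"
      unfolding M_def using that by (intro funpow_successor_mean_cong) (simp_all add: states_def)
    finally show ?thesis .
  qed
  have increment: "arc_weight q r \<beta> M e = \<phi> (head (de_bruijn d) e) - \<phi> (tail (de_bruijn d) e)"
    if "e \<in> arcs (de_bruijn d)" for e
  proof (cases e)
    case (Pair m b)
    have "c m - M = (\<phi> (state_plus m) + \<phi> (state_minus m)) / 2 - \<phi> m"
      using poisson[of m] that by (simp add: Pair de_bruijn_def successor_mean_def)
    then show ?thesis
      by (simp add: Pair de_bruijn_def arc_weight_def \<beta>_def c_def field_simps)
  qed
  have "cycle_sum q r \<beta> s = real (length s) * M" if cyc: "simple_cycle d s" for s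
  proof -
    obtain u where "awalk u s u" using cyc unfolding cycle_def by auto
    then have "sum_list (map (arc_weight q r \<beta> M) s) = 0"
      using sum_list_awalk_potential[of u s u "arc_weight q r \<beta> M" \<phi>] increment by simp
    then show ?thesis by (simp add: sum_list_arc_weight_cycle[OF assms cyc])
  qed
  then show ?thesis by blast
qed

theorem mainTheorem4:
  fixes d :: nat and q r :: "bool list \<Rightarrow> real"
  assumes "d \<in> {1, 2, 3, 4}"
    and "expert d q" and "expert d r"
    and "\<exists>m\<in>states d. q m \<noteq> r m"
  shows "(\<exists>\<beta> M. \<forall>s. simple_cycle d s \<longrightarrow> cycle_sum q r \<beta> s = real (length s) * M) \<and>
         (\<exists>V. investor_optimal_value d q r V \<and> market_optimal_value d q r V)"
proof -
  have d: "d \<ge> 1" using assms(1) by auto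
  obtain \<beta> M where indiff: "\<forall>s. simple_cycle d s \<longrightarrow> cycle_sum q r \<beta> s = real (length s) * M"
    using indifference_exists[OF d] by blast
  then have feas: "investor_feasible d q r \<beta> M" "market_feasible d q r \<beta> M"
    by (simp_all add: investor_feasible_def market_feasible_def)
  have mean: "(\<Sum>m\<in>states d. (q m - r m)\<^sup>2) = real (card (states d)) * M"
    using investor_feasible_ge_mean[OF d feas(1)] market_feasible_le_mean[OF d feas(2)] by simp
  have pos: "real (card (states d)) > 0"
    using assms(4) finite_states[of d] by (auto simp: card_gt_0_iff)
  have "M \<le> M'" if "investor_feasible d q r \<beta>' M'" for \<beta>' M'
    using investor_feasible_ge_mean[OF d that] mean pos by simp
  moreover have "M' \<le> M" if "market_feasible d q r \<beta>' M'" for \<beta>' M'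
    using market_feasible_le_mean[OF d that] mean pos by simp
  ultimately have "investor_optimal_value d q r M" "market_optimal_value d q r M"
    using feas unfolding investor_optimal_value_def market_optimal_value_def by blast+
  with indiff show ?thesis by blast
qed

end
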